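(* Let $(\Omega,\Sigma,\mathcal P)$ be a phantom probability space, let $\precsim$ be a weak order on $\mathbb{PH}$ as described in the context, and let $X:\Omega\to\mathbb{PH}$ be a phantom random variable that takes only values $\succsim 0$. Then: (i) $\mathcal P(X\succsim z)\precsim \dfrac{\mathrm E[X]}{z}$ for any pseudo positive $z\in\mathbb{PH}$; (ii) $\mathcal P(|X|\ge|z|)\precsim\dfrac{\mathrm E[|X|]}{|z|}$ for any nonzero $z\in\mathbb{PH}$; (iii) $\bigl|\mathcal P(|X|\ge|z|)\bigr|\le\left|\dfrac{\mathrm E[|X|]}{|z|}\right|$ for any nonzero $z\in\mathbb{PH}$.
   Context: The ring of phantom numbers $\mathbb{PH}$ is the set $\mathbb R\times\mathbb R$, with elements written $z=a+\wp b$ ($a=\operatorname{re}(z)$, $b=\operatorname{ph}(z)$), addition componentwise and multiplication $(a_1+\wp b_1)(a_2+\wp b_2)=a_1a_2+\wp(a_1b_2+b_1a_2+b_1b_2)$. Reals embed by $a\mapsto a+\wp0$. The reduction of $z$ is $\hat z=a+b$. An element is zero or a zero divisor iff $a=0$ or $\hat z=0$; all other elements are invertible, and $z_1/z_2:=z_1z_2^{-1}$. $z$ is pseudo positive if $a>0$ and $\hat z>0$. The absolute value is $|a+\wp b|=\sqrt{(a+b/2)^2+(b/2)^2}\in\mathbb R$. A weak order $\precsim$ on $\mathbb{PH}$ is a reflexive, transitive relation for which any two elements are comparable; $z\succsim w$ means $w\precsim z$. It is assumed that: for real $a_1,a_2$, $a_1+\wp0\precsim a_2+\wp0$ iff $a_1\le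 a_2$; if $z_1\precsim z_2$ then $z_1+z_3\precsim z_2+z_3$ for all $z_3$; if $z_1\precsim z_2$ then $z_1z_3\precsim z_2z_3$ for pseudo positive $z_3$; if $z_1z_3\precsim z_2$ then $z_1\precsim z_2/z_3$ for pseudo positive $z_3$; and $0\precsim z\precsim1$ for every $z=a+\wp b$ with $a\in[0,1]$ and $-a\le b\le1-a$. A phantom probability measure on a $\sigma$-algebra $\Sigma$ over $\Omega$ is $\mathcal P=\mathcal P_{\mathrm{re}}+\wp\mathcal P_{\mathrm{ph}}:\Sigma\to\mathbb{PH}$ with: $0\le\mathcal P_{\mathrm{re}}(A)\le1$; $\mathcal P(\Omega)=1$; $\mathcal P(A\cup B)=\mathcal P(A)+\mathcal P(B)$ for disjoint $A,B$; $-\mathcal P_{\mathrm{re}}(A)\le\mathcal P_{\mathrm{ph}}(A)\le1-\mathcal P_{\mathrm{re}}(A)$. Both $\mathcal P_{\mathrm{re}}$ and $\hat{\mathcal P}=\mathcal P_{\mathrm{re}}+\mathcal P_{\mathrm{ph}}$ are standard real probability measures. Throughout, all values of $\mathcal P$ are assumed not to be zero divisors (so each is $0$ or pseudo positive). A phantom random variable is a function $X:\Omega\to\mathbb{PH}$, discrete or continuous. If $X$ is discrete (countable range), $p_X(x)=\mathcal P(X=x)$ and $\mathrm E[g(X)]=\sum_x g(x)p_X(x)$. If $X$ is continuous, its range is a path $x(t)=a(t)+\wp b(t)$, $t\in\mathbb R$, without self-intersections and piecewise differentiable, there is a density $f_X:\mathbb{PH}\to\mathbb{PH}$ with $\mathcal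 P(X\in S)=\int f_X(x(t))\,x'(t)\,dt$ (integrated componentwise over the $t$ with $x(t)\in S$), and $\mathrm E[g(X)]=\int g(x(t))f_X(x(t))x'(t)\,dt$. Expectations are assumed to exist. $\mathrm E[|X|]$ is a phantom number in general. *)

theory Defs
  imports "HOL-Analysis.Analysis"
begin

section \<open>The ring of phantom numbers\<close>

datatype phantom_num = PNum (re: real) (ph: real)

lemma phantom_eq_iff: "z = w \<longleftrightarrow> re z = re w \<and> ph z = ph w"
  by (cases z; cases w) auto

definition reduction :: "phantom_num \<Rightarrow> real" where
  "reduction z = re z + ph z"

instantiation phantom_num :: comm_ring_1
begin

definition "0 = PNum 0 0"
definition "1 = PNum 1 0"
definition "z + w = PNum (re z + re w) (ph z + ph w)"
definition "- z = PNum (- re z) (- ph z)"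
definition "z - w = PNum (re z - re w) (ph z - ph w)"
definition "z * w = PNum (re z * re w) (re z * ph w + ph z * re w + ph z * ph w)"

instance
  by standard
    (auto simp: zero_phantom_num_def one_phantom_num_def plus_phantom_num_def
      uminus_phantom_num_def minus_phantom_num_def times_phantom_num_def algebra_simps)

end

lemma phantom_sel [simp]:
  "re 0 = 0" "ph 0 = 0" "re 1 = 1" "ph 1 = 0"
  "re (z + w) = re z + re w" "ph (z + w) = ph z + ph w"
  "re (- z) = - re z" "ph (- z) = - ph z"
  "re (z - w) = re z - re w" "ph (z - w) = ph z - ph w"
  "re (z * w) = re z * re w" "ph (z * w) = re z * ph w + ph z * re w + ph z * ph w"
  by (simp_all add: zero_phantom_num_def one_phantom_num_def plus_phantom_num_def
      uminus_phantom_num_def minus_phantom_num_def times_phantom_num_def)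

definition zero_divisor :: "phantom_num \<Rightarrow> bool" where
  "zero_divisor z \<longleftrightarrow> z \<noteq> 0 \<and> (\<exists>w. w \<noteq> 0 \<and> z * w = 0)"

definition pseudo_positive :: "phantom_num \<Rightarrow> bool" where
  "pseudo_positive z \<longleftrightarrow> re z > 0 \<and> reduction z > 0"

lemma zero_or_zero_divisor_iff: "z = 0 \<or> zero_divisor z \<longleftrightarrow> re z = 0 \<or> reduction z = 0"
proof
  assume "z = 0 \<or> zero_divisor z"
  then obtain w where w: "w \<noteq> 0" "z * w = 0"
    unfolding zero_divisor_def using zero_neq_one[where 'a = phantom_num] by (metis mult_zero_left)
  have "re z * re w = 0" "reduction z * (re w + ph w) = 0"
    using w(2) by (auto simp: phantom_eq_iff reduction_def algebra_simps)
  then show "re z = 0 \<or> reduction z = 0"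
    using w(1) by (auto simp: phantom_eq_iff)
next
  assume "re z = 0 \<or> reduction z = 0"
  then have "z * PNum 1 (-1) = 0 \<or> z * PNum 0 1 = 0"
    by (auto simp: phantom_eq_iff reduction_def)
  moreover have "PNum 1 (-1) \<noteq> 0" "PNum 0 1 \<noteq> 0"
    by (auto simp: phantom_eq_iff)
  ultimately show "z = 0 \<or> zero_divisor z"
    unfolding zero_divisor_def by blast
qed

text \<open>In the coordinates \<open>(re z, reduction z)\<close> multiplication is componentwise, which gives the
  formula for the inverse.  Elements without an inverse are mapped to 0.\<close>

instantiation phantom_num :: inverse
begin

definition "inverse z =
  (if re z = 0 \<or> reduction z = 0 then 0 else PNum (1 / re z) (1 / reduction z - 1 / re z))"
definition "z div w = z * inverse (w :: phantom_num)"

instance ..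

end

lemma phantom_right_inverse:
  assumes "re z \<noteq> 0" "reduction z \<noteq> 0"
  shows "z * inverse z = 1"
proof (cases z)
  case (PNum a b)
  with assms have "a \<noteq> 0" "a + b \<noteq> 0" by (auto simp: reduction_def)
  have "a / (a + b) + (b / (a + b) - 1) = 0"
    using \<open>a + b \<noteq> 0\<close> by (simp add: field_simps)
  with PNum \<open>a \<noteq> 0\<close> \<open>a + b \<noteq> 0\<close> show ?thesis
    by (simp add: phantom_eq_iff inverse_phantom_num_def reduction_def right_diff_distrib
        ring_distribs(2))
qed

instantiation phantom_num :: real_algebra_1
begin

definition "scaleR r z = PNum (r * re z) (r * ph z)"

instance
  by standard (auto simp: phantom_eq_iff scaleR_phantom_num_def algebra_simps)

end

lemma phantom_scaleR_sel [simp]: "re (r *\<^sub>R z) = r * re z" "ph (r *\<^sub>R z) = r * ph z"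
  by (simp_all add: scaleR_phantom_num_def)

lemma of_real_phantom: "of_real r = PNum r 0"
  by (simp add: of_real_def phantom_eq_iff)

text \<open>The phantom absolute value is taken as the norm; it comes from an inner product.\<close>

instantiation phantom_num :: real_inner
begin

definition "inner z w = (re z + ph z / 2) * (re w + ph w / 2) + (ph z / 2) * (ph w / 2)"
definition "norm z = sqrt ((re z + ph z / 2)\<^sup>2 + (ph z / 2)\<^sup>2)"
definition "sgn z = z /\<^sub>R norm (z :: phantom_num)"
definition "dist z w = norm (z - w :: phantom_num)"
definition [code del]:
  "(uniformity :: (phantom_num \<times> phantom_num) filter) =
    (INF e\<in>{0 <..}. principal {(x, y). dist x y < e})"
definition [code del]:
  "open (U :: phantom_num set) \<longleftrightarrow> (\<forall>x\<in>U. eventually (\<lambda>(x', y). x' = x \<longrightarrow> y \<in> U) uniformity)"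

instance
proof
  fix r :: real and x y z :: phantom_num and U :: "phantom_num set"
  show "sgn x = x /\<^sub>R norm x" by (rule sgn_phantom_num_def)
  show "dist x y = norm (x - y)" by (rule dist_phantom_num_def)
  show "(uniformity :: (phantom_num \<times> phantom_num) filter) =
      (INF e\<in>{0 <..}. principal {(x, y). dist x y < e})"
    by (rule uniformity_phantom_num_def)
  show "open U \<longleftrightarrow> (\<forall>x\<in>U. eventually (\<lambda>(x', y). x' = x \<longrightarrow> y \<in> U) uniformity)"
    by (rule open_phantom_num_def)
  show "inner x y = inner y x" "inner (x + y) z = inner x z + inner y z"
    "inner (r *\<^sub>R x) y = r * inner x y"
    by (simp_all add: inner_phantom_num_def scaleR_phantom_num_def field_simps)
  show "0 \<le> inner x x" by (simp add: inner_phantom_num_def)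
  show "inner x x = 0 \<longleftrightarrow> x = 0"
    by (auto simp: inner_phantom_num_def phantom_eq_iff sum_squares_eq_zero_iff
        simp flip: power2_eq_square)
  show "norm x = sqrt (inner x x)"
    by (simp add: norm_phantom_num_def inner_phantom_num_def power2_eq_square)
qed

end

text \<open>An orthonormal basis, so that limits, Borel sets and the Bochner integral are the
  componentwise ones.\<close>

instantiation phantom_num :: euclidean_space
begin

definition "Basis = {PNum (sqrt 2) (- sqrt 2), PNum 0 (sqrt 2)}"

instance
proof
  show "(Basis :: phantom_num set) \<noteq> {}" "finite (Basis :: phantom_num set)"
    by (simp_all add: Basis_phantom_num_def)
  fix u v :: phantom_num
  show "inner u v = (if u = v then 1 else 0)" if "u \<in> Basis" "v \<in> Basis"
    using that
    by (auto simp: Basis_phantom_num_def inner_phantom_num_def phantom_eq_iff field_simps)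
  show "(\<forall>u\<in>Basis. inner v u = 0) \<longleftrightarrow> v = 0"
  proof
    assume *: "\<forall>u\<in>Basis. inner v u = 0"
    have "inner v (PNum (sqrt 2) (- sqrt 2)) = re v * sqrt 2 / 2"
      "inner v (PNum 0 (sqrt 2)) = (re v + ph v) * sqrt 2 / 2"
      by (simp_all add: inner_phantom_num_def field_simps)
    with * show "v = 0" by (simp add: Basis_phantom_num_def phantom_eq_iff)
  qed simp
qed

end

lemma bounded_linear_re: "bounded_linear re"
  by (rule linear_conv_bounded_linear[THEN iffD1], rule linearI) simp_all

lemma bounded_linear_ph: "bounded_linear ph"
  by (rule linear_conv_bounded_linear[THEN iffD1], rule linearI) simp_all

lemma integral_phantom_componentwise:
  fixes f :: "'a \<Rightarrow> phantom_num"
  assumes "integrable M f"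
  shows "integral\<^sup>L M f = PNum (LINT x|M. re (f x)) (LINT x|M. ph (f x))"
  using integral_bounded_linear[OF bounded_linear_re assms]
    integral_bounded_linear[OF bounded_linear_ph assms]
  by (simp add: phantom_eq_iff)


section \<open>Weak orders\<close>

locale phantom_weak_order =
  fixes le :: "phantom_num \<Rightarrow> phantom_num \<Rightarrow> bool" (infix "\<precsim>" 50)
  assumes refl: "z \<precsim> z"
    and trans: "z\<^sub>1 \<precsim> z\<^sub>2 \<Longrightarrow> z\<^sub>2 \<precsim> z\<^sub>3 \<Longrightarrow> z\<^sub>1 \<precsim> z\<^sub>3"
    and total: "z\<^sub>1 \<precsim> z\<^sub>2 \<or> z\<^sub>2 \<precsim> z\<^sub>1"
    and of_real_iff: "of_real a\<^sub>1 \<precsim> of_real a\<^sub>2 \<longleftrightarrow> a\<^sub>1 \<le> a\<^sub>2"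
    and add_right: "z\<^sub>1 \<precsim> z\<^sub>2 \<Longrightarrow> z\<^sub>1 + z\<^sub>3 \<precsim> z\<^sub>2 + z\<^sub>3"
    and mult_right: "z\<^sub>1 \<precsim> z\<^sub>2 \<Longrightarrow> pseudo_positive z\<^sub>3 \<Longrightarrow> z\<^sub>1 * z\<^sub>3 \<precsim> z\<^sub>2 * z\<^sub>3"
    and le_divide: "z\<^sub>1 * z\<^sub>3 \<precsim> z\<^sub>2 \<Longrightarrow> pseudo_positive z\<^sub>3 \<Longrightarrow> z\<^sub>1 \<precsim> z\<^sub>2 / z\<^sub>3"
    and unit_range: "0 \<le> a \<Longrightarrow> a \<le> 1 \<Longrightarrow> - a \<le> b \<Longrightarrow> b \<le> 1 - a \<Longrightarrow>
      0 \<precsim> PNum a b \<and> PNum a b \<precsim> 1"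


section \<open>Phantom probability spaces and random variables\<close>

text \<open>The two assumptions \<open>measure_space\<close> say that the real part and the reduction of \<open>P\<close> are
  countably additive; their values are nonnegative by the range assumptions, so \<open>ennreal\<close> does not
  truncate.\<close>

locale phantom_prob_space = sigma_algebra \<Omega> \<Sigma>
  for \<Omega> :: "'w set" and \<Sigma> :: "'w set set" +
  fixes P :: "'w set \<Rightarrow> phantom_num"
  assumes re_range: "A \<in> \<Sigma> \<Longrightarrow> 0 \<le> re (P A) \<and> re (P A) \<le> 1"
    and ph_range: "A \<in> \<Sigma> \<Longrightarrow> - re (P A) \<le> ph (P A) \<and> ph (P A) \<le> 1 - re (P A)"
    and P_space: "P \<Omega> = 1"
    and P_Un: "A \<in> \<Sigma> \<Longrightarrow> B \<in> \<Sigma> \<Longrightarrow> A \<inter> B = {} \<Longrightarrow> P (A \<union> B) = P A + P B"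
    and measure_space_re: "measure_space \<Omega> \<Sigma> (\<lambda>A. ennreal (re (P A)))"
    and measure_space_reduction: "measure_space \<Omega> \<Sigma> (\<lambda>A. ennreal (reduction (P A)))"
    and not_zero_divisor: "A \<in> \<Sigma> \<Longrightarrow> \<not> zero_divisor (P A)"

definition discrete_rv :: "'w set \<Rightarrow> 'w set set \<Rightarrow> ('w \<Rightarrow> phantom_num) \<Rightarrow> bool" where
  "discrete_rv \<Omega> \<Sigma> X \<longleftrightarrow> countable (X ` \<Omega>) \<and> (\<forall>x. {\<omega>\<in>\<Omega>. X \<omega> = x} \<in> \<Sigma>)"

text \<open>The path \<open>x\<close> may have infinitely many breakpoints, but only finitely many in each bounded
  interval.  At a breakpoint the value of \<open>vector_derivative\<close> is irrelevant to the integral.\<close>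

definition continuous_rv ::
  "'w set \<Rightarrow> 'w set set \<Rightarrow> ('w set \<Rightarrow> phantom_num) \<Rightarrow> ('w \<Rightarrow> phantom_num) \<Rightarrow>
    (real \<Rightarrow> phantom_num) \<Rightarrow> (phantom_num \<Rightarrow> phantom_num) \<Rightarrow> bool" where
  "continuous_rv \<Omega> \<Sigma> P X x f \<longleftrightarrow>
    inj x \<and> (\<forall>s t. x piecewise_differentiable_on {s..t}) \<and> X ` \<Omega> = range x \<and>
    integrable lebesgue (\<lambda>t. f (x t) * vector_derivative x (at t)) \<and>
    (\<forall>S\<in>sets borel. {\<omega>\<in>\<Omega>. X \<omega> \<in> S} \<in> \<Sigma> \<and>
      P {\<omega>\<in>\<Omega>. X \<omega> \<in> S} =
        (LINT t:{t. x t \<in> S}|lebesgue. f (x t) * vector_derivative x (at t)))"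

definition phantom_rv ::
  "'w set \<Rightarrow> 'w set set \<Rightarrow> ('w set \<Rightarrow> phantom_num) \<Rightarrow> ('w \<Rightarrow> phantom_num) \<Rightarrow> bool" where
  "phantom_rv \<Omega> \<Sigma> P X \<longleftrightarrow> discrete_rv \<Omega> \<Sigma> X \<or> (\<exists>x f. continuous_rv \<Omega> \<Sigma> P X x f)"

text \<open>The expectation of \<open>g(X)\<close> exists and has the value \<open>e\<close>.  The two cases exclude each other,
  since the range of an injective path is uncountable.\<close>

definition has_expectation ::
  "'w set \<Rightarrow> 'w set set \<Rightarrow> ('w set \<Rightarrow> phantom_num) \<Rightarrow> ('w \<Rightarrow> phantom_num) \<Rightarrow>
    (phantom_num \<Rightarrow> phantom_num) \<Rightarrow> phantom_num \<Rightarrow> bool" where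
  "has_expectation \<Omega> \<Sigma> P X g e \<longleftrightarrow>
    discrete_rv \<Omega> \<Sigma> X \<and> ((\<lambda>x. g x * P {\<omega>\<in>\<Omega>. X \<omega> = x}) has_sum e) (X ` \<Omega>) \<or>
    (\<exists>x f. continuous_rv \<Omega> \<Sigma> P X x f \<and>
      has_bochner_integral lebesgue (\<lambda>t. g (x t) * f (x t) * vector_derivative x (at t)) e)"

end

theory Submission
  imports Defs
begin

text \<open>In the coordinates \<open>(re z, reduction z)\<close> the ring is \<open>\<real> \<times> \<real>\<close> with componentwise operations, and
  the pseudo positive elements form the open first quadrant.  As in the classical proof of Markov's
  inequality, the expectation of the pointwise estimate \<open>1\<^sub>A z \<precsim> X\<close>, where \<open>A = {z \<precsim> X}\<close>, should give
  \<open>z P(A) \<precsim> E[X]\<close>, and dividing by \<open>z\<close> finishes.  The difficulty is that \<open>{z. 0 \<precsim> z}\<close> need not be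
  closed (it is for instance a half-plane with half of its boundary line removed, for a
  lexicographic order), so monotonicity of the expectation does not follow by passing to limits.

  Two facts replace such an argument.  First, the integral of a function with values in a convex
  cone of a Euclidean space lies in that cone, whether or not the cone is closed
  (\<open>integral_in_convex_cone\<close>).  Second, \<open>P\<close> is given by a weight that is almost everywhere \<open>0\<close> or
  pseudo positive, so that multiplication by it preserves the order: in the discrete case the
  weights are the probabilities of the values; in the continuous case the weight is
  \<open>f(x(t)) x'(t)\<close>, and the claim (\<open>continuous_rv_density\<close>) comes from testing the weight on compact
  sets of parameters, whose integrals are values of \<open>P\<close>.

  Together they give Markov's inequality with respect to any convex cone that is stable under
  multiplication by pseudo positive elements (\<open>markov_in_cone\<close>).  Part (i) uses the cone
  \<open>{z. 0 \<precsim> z}\<close>.  Parts (ii) and (iii) use the closed first quadrant: the quadrant lies in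
  \<open>{z. 0 \<precsim> z}\<close>, and on it the norm is monotone in both coordinates.\<close>

section \<open>Integrals of cone-valued functions\<close>

text \<open>If the integral \<open>I\<close> were outside \<open>K\<close>, a hyperplane through the origin would weakly separate it from
  \<open>K\<close>.  The separating functional is nonnegative on the function and has nonpositive integral, so it
  vanishes almost everywhere.  Hence the function and \<open>I\<close> live in the hyperplane, and induction on
  the dimension applies.  Separating \<open>0\<close> from \<open>K \<inter> V - I\<close> with a functional from its span keeps the
  functional nontrivial on the current subspace \<open>V\<close>, so that the dimension does drop.\<close>

lemma integral_in_convex_cone:
  fixes h :: "'a \<Rightarrow> 'b::euclidean_space"
  assumes K: "convex_cone K" and h: "integrable M h" and hK: "AE t in M. h t \<in> K"
  shows "integral\<^sup>L M h \<in> K"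
proof -
  let ?I = "integral\<^sup>L M h"
  have "\<lbrakk>subspace V; ?I \<in> V; AE t in M. h t \<in> V; dim V \<le> n\<rbrakk> \<Longrightarrow> ?I \<in> K" for n and V :: "'b set"
  proof (induction n arbitrary: V)
    case 0
    then have "?I = 0" by (auto simp: dim_eq_0)
    then show ?case using K convex_cone_contains_0 by metis
  next
    case (Suc n)
    show ?case
    proof (rule ccontr)
      assume notin: "?I \<notin> K"
      have KV: "convex_cone (K \<inter> V)"
        using K \<open>subspace V\<close> unfolding convex_cone_iff by (auto simp: subspace_def)
      define S where "S = (+) (- ?I) ` (K \<inter> V)"
      have "convex S"
        using KV unfolding S_def convex_cone_def by auto
      moreover have "S \<noteq> {}" using KV unfolding S_def convex_cone_def by auto
      moreover have "0 \<notin> S" using notin by (auto simp: S_def)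
      ultimately obtain a where a: "a \<in> span S" "a \<noteq> 0" "\<And>x. x \<in> S \<Longrightarrow> 0 \<le> a \<bullet> x"
        using separating_hyperplane_set_0_inspan by metis
      have "S \<subseteq> V"
        using \<open>?I \<in> V\<close> \<open>subspace V\<close> by (auto simp: S_def subspace_add subspace_neg subspace_diff)
      then have aV: "a \<in> V" using a(1) \<open>subspace V\<close> by (meson span_minimal subsetD)
      have sep: "a \<bullet> ?I \<le> a \<bullet> k" if "k \<in> K \<inter> V" for k
        using a(3)[of "- ?I + k"] that by (auto simp: S_def inner_diff_right)
      have aI: "a \<bullet> ?I \<le> 0"
        using sep[of 0] convex_cone_contains_0[OF KV] by simp
      \<comment> \<open>A linear functional that is bounded below on a cone is nonnegative there.\<close>
      have nonneg: "0 \<le> a \<bullet> k" if "k \<in> K \<inter> V" for k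
      proof (rule ccontr)
        assume neg: "\<not> 0 \<le> a \<bullet> k"
        define c where "c = (a \<bullet> ?I - 1) / (a \<bullet> k)"
        have "c \<ge> 0" using neg aI by (auto simp: c_def divide_nonpos_neg)
        then have "c *\<^sub>R k \<in> K \<inter> V" using KV that by (simp only: convex_cone_scaleR)
        then have "a \<bullet> ?I \<le> c * (a \<bullet> k)" using sep by fastforce
        then show False using neg by (simp add: c_def)
      qed
      have ae: "AE t in M. 0 \<le> a \<bullet> h t"
        using hK Suc.prems(3) by eventually_elim (auto intro: nonneg)
      have int: "integrable M (\<lambda>t. a \<bullet> h t)" "(LINT t|M. a \<bullet> h t) = a \<bullet> ?I"
        using h by simp_all
      have "a \<bullet> ?I = 0"
        using integral_nonneg_AE[OF ae] int aI by simp
      then have ae0: "AE t in M. a \<bullet> h t = 0"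
        using integral_nonneg_eq_0_iff_AE[OF int(1) ae] int(2) by simp
      let ?V = "V \<inter> {x. a \<bullet> x = 0}"
      have sub: "subspace ?V"
        using \<open>subspace V\<close> by (simp add: subspace_hyperplane subspace_inter)
      have "a \<notin> ?V" using \<open>a \<noteq> 0\<close> by simp
      then have "?V \<subset> V" using aV by blast
      then have "dim ?V < dim V"
        using sub \<open>subspace V\<close> by (metis dim_psubset span_eq_iff)
      moreover have "AE t in M. h t \<in> ?V"
        using Suc.prems(3) ae0 by eventually_elim auto
      ultimately have "?I \<in> K"
        using Suc.IH[of ?V] Suc.prems sub \<open>a \<bullet> ?I = 0\<close> by simp
      then show False using notin by contradiction
    qed
  qed
  from this[of UNIV "dim (UNIV :: 'b set)"] show ?thesis by simp
qed

section \<open>Phantom numbers\<close>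

lemma reduction_simps [simp]:
  "reduction 0 = 0" "reduction 1 = 1"
  "reduction (z + w) = reduction z + reduction w"
  "reduction (z - w) = reduction z - reduction w"
  "reduction (z * w) = reduction z * reduction w"
  "reduction (c *\<^sub>R z) = c * reduction z"
  "reduction (of_real c) = c"
  by (simp_all add: reduction_def algebra_simps of_real_phantom)

lemma re_of_real [simp]: "re (of_real c) = c"
  by (simp add: of_real_phantom)

lemma phantom_eqI: "re z = re w \<Longrightarrow> reduction z = reduction w \<Longrightarrow> z = w"
  by (simp add: phantom_eq_iff reduction_def)

lemma bounded_linear_reduction: "bounded_linear reduction"
  by (rule linear_conv_bounded_linear[THEN iffD1], rule linearI) simp_all

lemma bounded_linear_phantom_mult: "bounded_linear (\<lambda>w. z * w :: phantom_num)"
  by (rule linear_conv_bounded_linear[THEN iffD1], rule linearI)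
    (simp_all add: distrib_left)

lemma norm_phantom_num: "norm z = sqrt (((re z)\<^sup>2 + (reduction z)\<^sup>2) / 2)"
  by (simp add: norm_phantom_num_def reduction_def power2_eq_square field_simps)

lemma borel_measurable_re [measurable]: "re \<in> borel_measurable borel"
  and borel_measurable_reduction [measurable]: "reduction \<in> borel_measurable borel"
  by (intro borel_measurable_continuous_onI linear_continuous_on
      bounded_linear_re bounded_linear_reduction)+

lemma has_bochner_integral_phantomI:
  assumes "has_bochner_integral M (\<lambda>t. re (h t)) (re e)"
    and "has_bochner_integral M (\<lambda>t. reduction (h t)) (reduction e)"
  shows "has_bochner_integral M h e"
proof -
  have decomp: "z = re z *\<^sub>R PNum 1 (-1) + reduction z *\<^sub>R PNum 0 1" for z
    by (simp add: phantom_eq_iff reduction_def)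
  have "has_bochner_integral M (\<lambda>t. re (h t) *\<^sub>R PNum 1 (-1) + reduction (h t) *\<^sub>R PNum 0 1)
      (re e *\<^sub>R PNum 1 (-1) + reduction e *\<^sub>R PNum 0 1)"
    by (intro has_bochner_integral_add has_bochner_integral_scaleR_left assms)
  then show ?thesis
    by (simp flip: decomp)
qed

lemma has_sum_imp_has_bochner_integral_real:
  fixes f :: "'a \<Rightarrow> real"
  assumes "(f has_sum s) A"
  shows "has_bochner_integral (count_space A) f s"
proof -
  have "Infinite_Set_Sum.abs_summable_on f A"
    using assms summable_on_iff_abs_summable_on_real abs_summable_equivalent has_sum_imp_summable
    by blast
  moreover from this have "infsetsum f A = s"
    using assms infsetsum_infsum infsumI by metis
  ultimately show ?thesis
    by (simp add: has_bochner_integral_iff Infinite_Set_Sum.abs_summable_on_def infsetsum_def)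
qed

lemma has_sum_imp_has_bochner_integral_phantom:
  fixes f :: "'a \<Rightarrow> phantom_num"
  assumes "(f has_sum s) A"
  shows "has_bochner_integral (count_space A) f s"
  using has_sum_bounded_linear[OF bounded_linear_re assms]
    has_sum_bounded_linear[OF bounded_linear_reduction assms]
  by (intro has_bochner_integral_phantomI has_sum_imp_has_bochner_integral_real)
    (simp_all add: o_def)

section \<open>Cones of phantom numbers\<close>

text \<open>What the positive elements of a weak order and the first quadrant have in common; the stability
  under multiplication is what lets a density act on cone-valued functions.\<close>

definition phantom_cone :: "phantom_num set \<Rightarrow> bool" where
  "phantom_cone K \<longleftrightarrow> convex_cone K \<and> (\<forall>z\<in>K. \<forall>p. pseudo_positive p \<longrightarrow> z * p \<in> K)"

lemma phantom_cone_nonneg: "phantom_cone {z. 0 \<le> re z \<and> 0 \<le> reduction z}"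
  by (simp add: phantom_cone_def convex_cone_iff pseudo_positive_def)

text \<open>Multiplication by pseudo positive elements acts on the plane with nine orbits, one for each pair of
  signs of \<open>re\<close> and \<open>reduction\<close>.  A cone that is stable under it is a union of orbits, and each
  orbit is Borel.\<close>

lemma phantom_cone_borel:
  assumes "phantom_cone K"
  shows "K \<in> sets borel"
proof -
  \<comment> \<open>The representative of the orbit of \<open>z\<close> whose coordinates are the signs.\<close>
  define s where "s z = PNum (sgn (re z)) (sgn (reduction z) - sgn (re z))" for z
  have s_sel: "re (s z) = sgn (re z)" "reduction (s z) = sgn (reduction z)" for z
    by (simp_all add: s_def reduction_def)
  have s_iff: "s z \<in> K \<longleftrightarrow> z \<in> K" for z
  proof -
    define abs1 :: "real \<Rightarrow> real" where "abs1 r = (if r = 0 then 1 else \<bar>r\<bar>)" for r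
    have abs1: "abs1 r > 0" "sgn r * abs1 r = r" "r * (1 / abs1 r) = sgn r" for r
      by (auto simp: abs1_def sgn_if)
    \<comment> \<open>\<open>?p\<close> has the moduli of the coordinates as coordinates, with \<open>1\<close> in place of \<open>0\<close>, and \<open>?q\<close> is its inverse.\<close>
    let ?p = "PNum (abs1 (re z)) (abs1 (reduction z) - abs1 (re z))"
    let ?q = "PNum (1 / abs1 (re z)) (1 / abs1 (reduction z) - 1 / abs1 (re z))"
    have "reduction ?p = abs1 (reduction z)" "reduction ?q = 1 / abs1 (reduction z)"
      by (simp_all add: reduction_def)
    then have "pseudo_positive ?p" "pseudo_positive ?q" "s z * ?p = z" "z * ?q = s z"
      using abs1 by (auto simp: pseudo_positive_def s_sel simp del: times_divide_eq_right
          intro!: phantom_eqI)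
    then show ?thesis
      using assms unfolding phantom_cone_def by metis
  qed
  define F where "F = (\<lambda>(i, j). PNum i (j - i)) ` ({-1, 0, 1} \<times> {-1, 0, 1 :: real})"
  have "s z \<in> F" for z
    unfolding F_def s_def by (rule image_eqI[where x = "(sgn (re z), sgn (reduction z))"])
      (auto simp: sgn_if)
  then have "K = (\<Union>w\<in>F \<inter> K. {z. sgn (re z) = re w \<and> sgn (reduction z) = reduction w})"
  proof (intro equalityI subsetI)
    fix z assume "z \<in> K"
    then have "s z \<in> F \<inter> K" using s_iff \<open>s z \<in> F\<close> by simp
    then show "z \<in> (\<Union>w\<in>F \<inter> K. {z. sgn (re z) = re w \<and> sgn (reduction z) = reduction w})"
      by (intro UN_I[of "s z"]) (simp_all add: s_sel)
  next
    fix z assume "z \<in> (\<Union>w\<in>F \<inter> K. {z. sgn (re z) = re w \<and> sgn (reduction z) = reduction w})"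
    then obtain w where "w \<in> K" "re (s z) = re w" "reduction (s z) = reduction w"
      using s_sel by auto
    then have "s z \<in> K" using phantom_eqI[of "s z" w] by simp
    then show "z \<in> K" using s_iff by simp
  qed
  also have "\<dots> \<in> sets borel"
    by (intro sets.finite_UN) (auto simp: F_def)
  finally show ?thesis .
qed

context phantom_weak_order
begin

text \<open>Scaling by a large real number reduces this to the unit square of the coordinates, where it is an
  axiom of weak orders.\<close>

lemma nonneg_imp_ge_0:
  assumes "0 \<le> re z" "0 \<le> reduction z"
  shows "0 \<precsim> z"
proof -
  define c where "c = max 1 (max (re z) (reduction z))"
  have "c \<ge> 1" "re z \<le> c" "reduction z \<le> c" by (auto simp: c_def)
  then have "0 \<precsim> PNum (re z / c) (ph z / c)"
    using assms by (intro unit_range[THEN conjunct1])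
      (auto simp: reduction_def field_simps)
  moreover have "pseudo_positive (of_real c)"
    using \<open>c \<ge> 1\<close> by (simp add: pseudo_positive_def)
  ultimately have "0 * of_real c \<precsim> PNum (re z / c) (ph z / c) * of_real c"
    by (rule mult_right)
  moreover have "PNum (re z / c) (ph z / c) * of_real c = z"
    using \<open>c \<ge> 1\<close> by (simp add: phantom_eq_iff of_real_phantom)
  ultimately show ?thesis by simp
qed

lemma le_iff_diff: "z \<precsim> w \<longleftrightarrow> 0 \<precsim> w - z"
  using add_right[of z w "- z"] add_right[of 0 "w - z" z] by auto

lemma phantom_cone_ge_0: "phantom_cone {z. 0 \<precsim> z}"
proof -
  have "0 \<precsim> z + w" if "0 \<precsim> z" "0 \<precsim> w" for z w
    using add_right[OF that(1), of w] that(2) trans by simp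
  moreover have mult: "0 \<precsim> z * p" if "0 \<precsim> z" "pseudo_positive p" for z p
    using mult_right[OF that] by simp
  moreover have "0 \<precsim> c *\<^sub>R z" if "0 \<precsim> z" "c \<ge> 0" for c z
  proof (cases "c = 0")
    case False
    then have "pseudo_positive (of_real c)" using that by (simp add: pseudo_positive_def)
    then have "0 \<precsim> z * of_real c" using that by (blast intro: mult)
    also have "z * of_real c = c *\<^sub>R z" by (simp add: phantom_eq_iff of_real_phantom)
    finally show ?thesis .
  qed (simp add: refl)
  ultimately show ?thesis
    by (simp add: phantom_cone_def convex_cone_iff refl)
qed

lemma ge_borel: "{w. z \<precsim> w} \<in> sets borel"
proof -
  have "(\<lambda>w. w - z) -` {w. 0 \<precsim> w} \<inter> space borel \<in> sets borel"
    by (rule measurable_sets[OF _ phantom_cone_borel[OF phantom_cone_ge_0]]) simp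
  also have "(\<lambda>w. w - z) -` {w. 0 \<precsim> w} \<inter> space borel = {w. z \<precsim> w}"
    using le_iff_diff[of z] by auto
  finally show ?thesis .
qed

end

section \<open>Phantom probabilities as integrals of pseudo positive weights\<close>

context phantom_prob_space
begin

lemma P_zero_or_pseudo_positive:
  assumes "A \<in> \<Sigma>"
  shows "P A = 0 \<or> pseudo_positive (P A)"
proof (cases "P A = 0")
  case False
  then have "re (P A) \<noteq> 0" "reduction (P A) \<noteq> 0"
    using zero_or_zero_divisor_iff[of "P A"] not_zero_divisor[OF assms] by auto
  then show ?thesis
    using re_range[OF assms] ph_range[OF assms]
    by (auto simp: pseudo_positive_def reduction_def)
qed simp

lemma P_nonneg:
  assumes "A \<in> \<Sigma>"
  shows "0 \<le> re (P A)" "0 \<le> reduction (P A)"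
  using re_range[OF assms] ph_range[OF assms] by (auto simp: reduction_def)

text \<open>Countable additivity of one coordinate of \<open>P\<close>, over the level sets of \<open>X\<close>, in the form needed to
  treat sums over the range of \<open>X\<close> as integrals for a counting measure.\<close>

lemma has_bochner_integral_countable_partition:
  fixes m :: "'w set \<Rightarrow> real" and X :: "'w \<Rightarrow> 'b"
  assumes ms: "measure_space \<Omega> \<Sigma> (\<lambda>A. ennreal (m A))" and nonneg: "\<And>A. A \<in> \<Sigma> \<Longrightarrow> 0 \<le> m A"
    and I: "countable I" and X: "\<And>x. {\<omega>\<in>\<Omega>. X \<omega> = x} \<in> \<Sigma>"
    and S: "{\<omega>\<in>\<Omega>. X \<omega> \<in> S} \<in> \<Sigma>" and sub: "X ` \<Omega> \<subseteq> I"
  shows "has_bochner_integral (count_space I)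
    (\<lambda>x. indicator S x * m {\<omega>\<in>\<Omega>. X \<omega> = x}) (m {\<omega>\<in>\<Omega>. X \<omega> \<in> S})"
proof -
  define N where "N = measure_of \<Omega> \<Sigma> (\<lambda>A. ennreal (m A))"
  have sets: "sets N = \<Sigma>" unfolding N_def using sets_measure_of_eq by simp
  have em: "emeasure N A = ennreal (m A)" if "A \<in> \<Sigma>" for A
    unfolding N_def using ms that
    by (simp add: emeasure_measure_of_sigma measure_space_def)
  define B where "B x = (if x \<in> S then {\<omega>\<in>\<Omega>. X \<omega> = x} else {})" for x
  have B: "B x \<in> \<Sigma>" for x using X by (simp add: B_def)
  have "{\<omega>\<in>\<Omega>. X \<omega> \<in> S} = (\<Union>x\<in>I. B x)"
    using sub by (auto simp: B_def split: if_splits)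
  then have "ennreal (m {\<omega>\<in>\<Omega>. X \<omega> \<in> S}) = emeasure N (\<Union>x\<in>I. B x)"
    using em[OF S] by simp
  also have "\<dots> = (\<integral>\<^sup>+x. emeasure N (B x) \<partial>count_space I)"
    using I B by (intro emeasure_UN_countable)
      (auto simp: sets disjoint_family_on_def B_def)
  also have "\<dots> = (\<integral>\<^sup>+x. ennreal (indicator S x * m {\<omega>\<in>\<Omega>. X \<omega> = x}) \<partial>count_space I)"
    using em[of "{}"] by (intro nn_integral_cong) (simp add: B_def em X)
  finally show ?thesis
    by (intro has_bochner_integral_nn_integral) (auto simp: nonneg X S)
qed

lemma discrete_rv_weights:
  assumes "discrete_rv \<Omega> \<Sigma> X"
  shows "{\<omega>\<in>\<Omega>. X \<omega> \<in> S} \<in> \<Sigma>"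
    and "has_bochner_integral (count_space (X ` \<Omega>))
      (\<lambda>x. indicator S x *\<^sub>R P {\<omega>\<in>\<Omega>. X \<omega> = x}) (P {\<omega>\<in>\<Omega>. X \<omega> \<in> S})"
proof -
  have c: "countable (X ` \<Omega>)" and X: "{\<omega>\<in>\<Omega>. X \<omega> = x} \<in> \<Sigma>" for x
    using assms by (auto simp: discrete_rv_def)
  have "{\<omega>\<in>\<Omega>. X \<omega> \<in> S} = (\<Union>x\<in>X ` \<Omega> \<inter> S. {\<omega>\<in>\<Omega>. X \<omega> = x})" by auto
  also have "\<dots> \<in> \<Sigma>"
    using c X by (intro countable_UN') auto
  finally show S: "{\<omega>\<in>\<Omega>. X \<omega> \<in> S} \<in> \<Sigma>" .
  show "has_bochner_integral (count_space (X ` \<Omega>))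
      (\<lambda>x. indicator S x *\<^sub>R P {\<omega>\<in>\<Omega>. X \<omega> = x}) (P {\<omega>\<in>\<Omega>. X \<omega> \<in> S})"
    using has_bochner_integral_countable_partition[OF measure_space_re P_nonneg(1) c X S]
      has_bochner_integral_countable_partition[OF measure_space_reduction P_nonneg(2) c X S]
    by (intro has_bochner_integral_phantomI) simp_all
qed

end

text \<open>Inner regularity: up to a null set, \<open>S\<close> is a countable union of compact sets.\<close>

lemma null_sets_lebesgue_if_compact_subsets_null:
  fixes S :: "'a::euclidean_space set"
  assumes "S \<in> sets lebesgue"
    and null: "\<And>C. compact C \<Longrightarrow> C \<subseteq> S \<Longrightarrow> C \<in> null_sets lebesgue"
  shows "S \<in> null_sets lebesgue"
proof -
  obtain C T where C: "fsigma C" "T \<in> null_sets lebesgue" "C \<union> T = S"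
    using lebesgue_set_almost_fsigma[OF assms(1)] by metis
  then obtain F :: "nat \<Rightarrow> 'a set" where F: "range F \<subseteq> Collect compact" "C = \<Union>(range F)"
    unfolding fsigma_Union_compact by auto
  have "F n \<in> null_sets lebesgue" for n
    using F C(3) by (intro null) auto
  then have "C \<in> null_sets lebesgue" using F(2) by auto
  then show ?thesis using C by auto
qed

lemma set_integral_pos_if_not_null:
  fixes f :: "'a \<Rightarrow> real"
  assumes f: "integrable M f" and A: "A \<in> sets M" "A \<notin> null_sets M"
    and pos: "\<And>t. t \<in> A \<Longrightarrow> 0 < f t"
  shows "0 < (LINT t:A|M. f t)"
proof -
  have int: "integrable M (\<lambda>t. indicator A t *\<^sub>R f t)"
    using integrable_mult_indicator[OF A(1) f] .
  have nonneg: "0 \<le> indicator A t *\<^sub>R f t" for t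
    using pos[of t] by (auto simp: indicator_def)
  have "(LINT t:A|M. f t) \<noteq> 0"
  proof
    assume "(LINT t:A|M. f t) = 0"
    then have "AE t in M. indicator A t *\<^sub>R f t = 0"
      using integral_nonneg_eq_0_iff_AE[OF int] nonneg by (simp add: set_lebesgue_integral_def)
    then have "AE t in M. t \<notin> A"
      by eventually_elim (use pos in \<open>force simp: indicator_def\<close>)
    then show False using A AE_iff_null_sets by blast
  qed
  moreover have "0 \<le> (LINT t:A|M. f t)"
    unfolding set_lebesgue_integral_def using nonneg by (intro integral_nonneg_AE) simp
  ultimately show ?thesis by simp
qed

text \<open>For compact \<open>C\<close> the image \<open>x ` C\<close> is compact, hence Borel, and its preimage under the injective \<open>x\<close> is
  \<open>C\<close>; so the integral of the weight over \<open>C\<close> is a value of \<open>P\<close>, that is \<open>0\<close> or pseudo positive.  If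
  the weight failed to be \<open>0\<close> or pseudo positive on a set of positive measure, then one of four sign
  patterns would occur on a compact set of positive measure, and the integral would inherit it.\<close>

lemma (in phantom_prob_space) continuous_rv_density:
  assumes "continuous_rv \<Omega> \<Sigma> P X x f"
  shows "AE t in lebesgue. f (x t) * vector_derivative x (at t) = 0 \<or>
    pseudo_positive (f (x t) * vector_derivative x (at t))"
proof -
  define h where "h t = f (x t) * vector_derivative x (at t)" for t
  have inj: "inj x" and pw: "\<And>s t. x piecewise_differentiable_on {s..t}"
    and h: "integrable lebesgue h"
    and PS: "\<And>S. S \<in> sets borel \<Longrightarrow> {\<omega>\<in>\<Omega>. X \<omega> \<in> S} \<in> \<Sigma>"
      "\<And>S. S \<in> sets borel \<Longrightarrow> P {\<omega>\<in>\<Omega>. X \<omega> \<in> S} = (LINT t:{t. x t \<in> S}|lebesgue. h t)"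
    using assms unfolding continuous_rv_def h_def by auto
  have [measurable]: "h \<in> borel_measurable lebesgue" using h by simp
  have int: "integrable lebesgue (\<lambda>t. re (h t))" "integrable lebesgue (\<lambda>t. reduction (h t))"
    using integrable_bounded_linear[OF bounded_linear_re h]
      integrable_bounded_linear[OF bounded_linear_reduction h] by simp_all
  have compact_integral: "(re p = 0 \<and> reduction p = 0 \<or> 0 < re p \<and> 0 < reduction p)
      \<and> re p = (LINT t:C|lebesgue. re (h t)) \<and> reduction p = (LINT t:C|lebesgue. reduction (h t))"
    if "compact C" and p: "p = (LINT t:C|lebesgue. h t)" for C p
  proof -
    obtain s t where "C \<subseteq> {s..t}"
      using \<open>compact C\<close> compact_imp_bounded bounded_subset_cbox_symmetric[of C] by (metis cbox_interval)
    then have "continuous_on C x"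
      using pw[of s t] piecewise_differentiable_on_imp_continuous_on continuous_on_subset by blast
    then have borel: "x ` C \<in> sets borel"
      using \<open>compact C\<close> compact_continuous_image compact_imp_closed borel_closed by metis
    have "{t. x t \<in> x ` C} = C" using inj by (auto dest: injD)
    then have "p = P {\<omega>\<in>\<Omega>. X \<omega> \<in> x ` C}"
      using PS(2)[OF borel] p by simp
    then have "p = 0 \<or> pseudo_positive p"
      using P_zero_or_pseudo_positive[OF PS(1)[OF borel]] by simp
    moreover have C: "C \<in> sets lebesgue"
      using \<open>compact C\<close> by (simp add: compact_imp_closed)
    have "re p = (LINT t:C|lebesgue. re (h t))" "reduction p = (LINT t:C|lebesgue. reduction (h t))"
      using integral_bounded_linear[OF bounded_linear_re integrable_mult_indicator[OF C h]]
        integral_bounded_linear[OF bounded_linear_reduction integrable_mult_indicator[OF C h]]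
      by (simp_all add: p set_lebesgue_integral_def)
    ultimately show ?thesis by (auto simp: pseudo_positive_def)
  qed
  have neg: "(LINT t:C|lebesgue. g t) < 0"
    if "integrable lebesgue g" "C \<in> sets lebesgue" "C \<notin> null_sets lebesgue" "\<And>t. t \<in> C \<Longrightarrow> g t < 0"
    for g :: "real \<Rightarrow> real" and C
    using set_integral_pos_if_not_null[of lebesgue "\<lambda>t. - g t" C] that
    by (simp add: set_lebesgue_integral_def)
  have zero: "(LINT t:C|lebesgue. g t) = 0" if "\<And>t. t \<in> C \<Longrightarrow> g t = 0" for g :: "real \<Rightarrow> real" and C
  proof -
    have "indicator C t *\<^sub>R g t = 0" for t using that by (simp add: indicator_def)
    then show ?thesis unfolding set_lebesgue_integral_def by (simp only: integral_zero)
  qed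
  have meas: "{t. Q t} \<in> sets lebesgue" if "Measurable.pred lebesgue Q" for Q :: "real \<Rightarrow> bool"
    using that by (simp add: pred_def)
  have null: "S \<in> null_sets lebesgue"
    if "S \<in> sets lebesgue"
      and "\<And>C. compact C \<Longrightarrow> C \<in> sets lebesgue \<Longrightarrow> C \<subseteq> S \<Longrightarrow> C \<notin> null_sets lebesgue \<Longrightarrow> False" for S
  proof (rule null_sets_lebesgue_if_compact_subsets_null[OF that(1)], rule ccontr)
    fix C assume C: "compact C" "C \<subseteq> S" "C \<notin> null_sets lebesgue"
    from C(1) have "C \<in> sets lebesgue" by (simp add: compact_imp_closed)
    with C show False using that(2)[of C] by blast
  qed
  have "{t. re (h t) < 0} \<in> null_sets lebesgue"
  proof (rule null)
    fix C assume C: "compact C" "C \<in> sets lebesgue" "C \<subseteq> {t. re (h t) < 0}" "C \<notin> null_sets lebesgue"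
    show False
      using C compact_integral[OF C(1) HOL.refl] neg[OF int(1), of C] by force
  qed (rule meas, measurable)
  moreover have "{t. reduction (h t) < 0} \<in> null_sets lebesgue"
  proof (rule null)
    fix C assume C: "compact C" "C \<in> sets lebesgue" "C \<subseteq> {t. reduction (h t) < 0}"
      "C \<notin> null_sets lebesgue"
    show False
      using C compact_integral[OF C(1) HOL.refl] neg[OF int(2), of C] by force
  qed (rule meas, measurable)
  moreover have "{t. re (h t) = 0 \<and> 0 < reduction (h t)} \<in> null_sets lebesgue"
  proof (rule null)
    fix C assume C: "compact C" "C \<in> sets lebesgue" "C \<subseteq> {t. re (h t) = 0 \<and> 0 < reduction (h t)}"
      "C \<notin> null_sets lebesgue"
    show False
      using C compact_integral[OF C(1) HOL.refl] zero[of C "\<lambda>t. re (h t)"]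
        set_integral_pos_if_not_null[OF int(2), of C] by force
  qed (rule meas, measurable)
  moreover have "{t. 0 < re (h t) \<and> reduction (h t) = 0} \<in> null_sets lebesgue"
  proof (rule null)
    fix C assume C: "compact C" "C \<in> sets lebesgue" "C \<subseteq> {t. 0 < re (h t) \<and> reduction (h t) = 0}"
      "C \<notin> null_sets lebesgue"
    show False
      using C compact_integral[OF C(1) HOL.refl] zero[of C "\<lambda>t. reduction (h t)"]
        set_integral_pos_if_not_null[OF int(1), of C] by force
  qed (rule meas, measurable)
  ultimately have "AE t in lebesgue. t \<notin> {t. re (h t) < 0} \<and> t \<notin> {t. reduction (h t) < 0} \<and>
      t \<notin> {t. re (h t) = 0 \<and> 0 < reduction (h t)} \<and> t \<notin> {t. 0 < re (h t) \<and> reduction (h t) = 0}"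
    by (intro AE_conjI AE_not_in)
  then have "AE t in lebesgue. h t = 0 \<or> pseudo_positive (h t)"
    by eventually_elim (auto simp: pseudo_positive_def intro: phantom_eqI)
  then show ?thesis by (simp add: h_def)
qed

section \<open>Markov's inequality\<close>

text \<open>Multiplication by the values of \<open>W\<close> preserves \<open>K\<close>, so \<open>(g - 1\<^sub>A c) W\<close> is almost everywhere in
  \<open>K\<close>, and \<open>e - c p\<close> is its integral.  In the application \<open>W\<close> represents \<open>P\<close>, which makes \<open>p\<close> a
  probability and \<open>e\<close> an expectation.\<close>

lemma weighted_markov:
  fixes g W :: "'a \<Rightarrow> phantom_num"
  assumes K: "phantom_cone K"
    and e: "has_bochner_integral M (\<lambda>t. g t * W t) e"
    and p: "has_bochner_integral M (\<lambda>t. indicator A t *\<^sub>R W t) p"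
    and W: "AE t in M. W t = 0 \<or> pseudo_positive (W t)"
    and g: "\<And>t. t \<in> space M \<Longrightarrow> g t - indicator A t *\<^sub>R c \<in> K"
  shows "e - c * p \<in> K"
proof -
  have "has_bochner_integral M (\<lambda>t. g t * W t - c * (indicator A t *\<^sub>R W t)) (e - c * p)"
    by (intro has_bochner_integral_diff e
        has_bochner_integral_bounded_linear[OF bounded_linear_phantom_mult p])
  then have int: "has_bochner_integral M (\<lambda>t. (g t - indicator A t *\<^sub>R c) * W t) (e - c * p)"
    by (simp add: algebra_simps)
  have "AE t in M. (g t - indicator A t *\<^sub>R c) * W t \<in> K"
    using W AE_space
  proof eventually_elim
    case (elim t)
    then show ?case
      using K g[of t] convex_cone_contains_0[of K] unfolding phantom_cone_def by fastforce
  qed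
  then show ?thesis
    using integral_in_convex_cone[of K M] K int
    unfolding phantom_cone_def has_bochner_integral_iff by metis
qed

lemma (in phantom_prob_space) markov_in_cone:
  assumes K: "phantom_cone K"
    and e: "has_expectation \<Omega> \<Sigma> P X g e"
    and S: "S \<in> sets borel"
    and g: "\<And>\<omega>. \<omega> \<in> \<Omega> \<Longrightarrow> g (X \<omega>) - indicator S (X \<omega>) *\<^sub>R c \<in> K"
  shows "e - c * P {\<omega>\<in>\<Omega>. X \<omega> \<in> S} \<in> K"
  using e unfolding has_expectation_def
proof (elim disjE exE conjE)
  assume d: "discrete_rv \<Omega> \<Sigma> X"
    and sum: "((\<lambda>x. g x * P {\<omega>\<in>\<Omega>. X \<omega> = x}) has_sum e) (X ` \<Omega>)"
  show ?thesis
  proof (rule weighted_markov[OF K])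
    show "has_bochner_integral (count_space (X ` \<Omega>)) (\<lambda>x. g x * P {\<omega>\<in>\<Omega>. X \<omega> = x}) e"
      by (rule has_sum_imp_has_bochner_integral_phantom[OF sum])
    show "has_bochner_integral (count_space (X ` \<Omega>))
        (\<lambda>x. indicator S x *\<^sub>R P {\<omega>\<in>\<Omega>. X \<omega> = x}) (P {\<omega>\<in>\<Omega>. X \<omega> \<in> S})"
      by (rule discrete_rv_weights(2)[OF d])
    show "AE x in count_space (X ` \<Omega>).
        P {\<omega>\<in>\<Omega>. X \<omega> = x} = 0 \<or> pseudo_positive (P {\<omega>\<in>\<Omega>. X \<omega> = x})"
      using d P_zero_or_pseudo_positive by (simp add: discrete_rv_def)
  qed (use g in auto)
next
  fix x f
  assume X: "continuous_rv \<Omega> \<Sigma> P X x f"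
    and int: "has_bochner_integral lebesgue (\<lambda>t. g (x t) * f (x t) * vector_derivative x (at t)) e"
  let ?W = "\<lambda>t. f (x t) * vector_derivative x (at t)"
  let ?A = "{t. x t \<in> S}"
  have W: "integrable lebesgue ?W"
    and PS: "P {\<omega>\<in>\<Omega>. X \<omega> \<in> S} = (LINT t:?A|lebesgue. ?W t)"
    and range: "X ` \<Omega> = range x"
    and pw: "\<And>s t. x piecewise_differentiable_on {s..t}"
    using X S by (auto simp: continuous_rv_def)
  have "continuous (at t) x" for t
  proof -
    have "continuous_on {t - 1..t + 1} x"
      using pw piecewise_differentiable_on_imp_continuous_on by blast
    then show ?thesis by (rule continuous_on_interior) simp
  qed
  then have "x \<in> borel_measurable borel"
    by (intro borel_measurable_continuous_onI continuous_at_imp_continuous_on) auto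
  then have "?A \<in> sets borel"
    using measurable_sets[of x borel borel S] S by (simp add: vimage_def)
  then have A: "?A \<in> sets lebesgue" by simp
  show ?thesis
  proof (rule weighted_markov[OF K])
    show "has_bochner_integral lebesgue (\<lambda>t. g (x t) * ?W t) e"
      using int by (simp add: mult.assoc)
    show "has_bochner_integral lebesgue (\<lambda>t. indicator ?A t *\<^sub>R ?W t) (P {\<omega>\<in>\<Omega>. X \<omega> \<in> S})"
      using integrable_mult_indicator[OF A W]
      by (simp add: has_bochner_integral_iff PS set_lebesgue_integral_def)
    show "AE t in lebesgue. ?W t = 0 \<or> pseudo_positive (?W t)"
      by (rule continuous_rv_density[OF X])
    fix t
    obtain \<omega> where "\<omega> \<in> \<Omega>" "X \<omega> = x t" using range by (metis imageE rangeI)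
    then show "g (x t) - indicator ?A t *\<^sub>R c \<in> K" using g[of \<omega>] by (simp add: indicator_def)
  qed
qed

lemma norm_phantom_mono:
  assumes "0 \<le> re z" "0 \<le> reduction z" "re z \<le> re w" "reduction z \<le> reduction w"
  shows "norm z \<le> norm w"
  unfolding norm_phantom_num using assms
  by (intro real_sqrt_le_mono divide_right_mono add_mono power_mono) auto

lemma divide_of_real_phantom: "z / of_real r = inverse r *\<^sub>R (z :: phantom_num)"
  by (rule phantom_eqI)
    (auto simp: divide_phantom_num_def inverse_phantom_num_def reduction_def of_real_phantom
      field_simps)

theorem proposition6p2:
  fixes \<Omega> :: "'w set" and \<Sigma> :: "'w set set" and P :: "'w set \<Rightarrow> phantom_num"
    and X :: "'w \<Rightarrow> phantom_num"
    and le :: "phantom_num \<Rightarrow> phantom_num \<Rightarrow> bool" (infix "\<precsim>" 50)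
  assumes "phantom_prob_space \<Omega> \<Sigma> P"
    and "phantom_weak_order (\<precsim>)"
    and "phantom_rv \<Omega> \<Sigma> P X"
    and "\<forall>\<omega>\<in>\<Omega>. 0 \<precsim> X \<omega>"
  shows "(\<forall>e::phantom_num. has_expectation \<Omega> \<Sigma> P X (\<lambda>x. x) e \<longrightarrow>
            (\<forall>z::phantom_num. pseudo_positive z \<longrightarrow> P {\<omega>\<in>\<Omega>. z \<precsim> X \<omega>} \<precsim> e / z)) \<and>
         (\<forall>e::phantom_num. has_expectation \<Omega> \<Sigma> P X (\<lambda>x. of_real (norm x)) e \<longrightarrow>
            (\<forall>z::phantom_num. z \<noteq> 0 \<longrightarrow>
              P {\<omega>\<in>\<Omega>. norm (X \<omega>) \<ge> norm z} \<precsim> e / of_real (norm z)) \<and>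
            (\<forall>z::phantom_num. z \<noteq> 0 \<longrightarrow>
              norm (P {\<omega>\<in>\<Omega>. norm (X \<omega>) \<ge> norm z}) \<le> norm (e / of_real (norm z))))"
proof -
  interpret phantom_prob_space \<Omega> \<Sigma> P by fact
  interpret phantom_weak_order "(\<precsim>)" by fact
  have i: "P {\<omega>\<in>\<Omega>. z \<precsim> X \<omega>} \<precsim> e / z"
    if e: "has_expectation \<Omega> \<Sigma> P X (\<lambda>x. x) e" and z: "pseudo_positive z" for e z
  proof -
    have "e - z * P {\<omega>\<in>\<Omega>. X \<omega> \<in> {w. z \<precsim> w}} \<in> {w. 0 \<precsim> w}"
    proof (rule markov_in_cone[OF phantom_cone_ge_0 e ge_borel])
      fix \<omega> assume "\<omega> \<in> \<Omega>"
      then show "X \<omega> - indicator {w. z \<precsim> w} (X \<omega>) *\<^sub>R z \<in> {w. 0 \<precsim> w}"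
        using assms(4) le_iff_diff[of z "X \<omega>"] by (simp add: indicator_def)
    qed
    then have "P {\<omega>\<in>\<Omega>. z \<precsim> X \<omega>} * z \<precsim> e"
      using le_iff_diff[of _ e] by (simp add: mult.commute)
    then show ?thesis using z by (rule le_divide)
  qed
  have bound: "0 \<le> re (P A)" "0 \<le> reduction (P A)"
      "re (P A) \<le> re (e / of_real (norm z))" "reduction (P A) \<le> reduction (e / of_real (norm z))"
    if e: "has_expectation \<Omega> \<Sigma> P X (\<lambda>x. of_real (norm x)) e" and z: "z \<noteq> 0"
      and A: "A = {\<omega>\<in>\<Omega>. norm (X \<omega>) \<ge> norm z}" for e z A
  proof -
    have borel: "{w. norm z \<le> norm (w :: phantom_num)} \<in> sets borel" by measurable
    have "e - of_real (norm z) * P {\<omega>\<in>\<Omega>. X \<omega> \<in> {w. norm z \<le> norm w}}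
        \<in> {w. 0 \<le> re w \<and> 0 \<le> reduction w}"
      by (rule markov_in_cone[OF phantom_cone_nonneg e borel]) (simp add: indicator_def)
    then have le: "norm z * re (P A) \<le> re e" "norm z * reduction (P A) \<le> reduction e"
      by (simp_all add: A)
    then show "re (P A) \<le> re (e / of_real (norm z))"
      "reduction (P A) \<le> reduction (e / of_real (norm z))"
      using z by (simp_all add: divide_of_real_phantom field_simps)
    have "A \<in> \<Sigma>"
      using e discrete_rv_weights(1)[of X "{w. norm z \<le> norm w}"] borel
      unfolding has_expectation_def continuous_rv_def A by fastforce
    then show "0 \<le> re (P A)" "0 \<le> reduction (P A)" by (rule P_nonneg)+
  qed
  show ?thesis
  proof (intro conjI allI impI)
    show "P {\<omega>\<in>\<Omega>. norm (X \<omega>) \<ge> norm z} \<precsim> e / of_real (norm z)"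
      if "has_expectation \<Omega> \<Sigma> P X (\<lambda>x. of_real (norm x)) e" "z \<noteq> 0" for e z
      using bound[OF that HOL.refl]
      by (subst le_iff_diff) (auto intro: nonneg_imp_ge_0)
    show "norm (P {\<omega>\<in>\<Omega>. norm (X \<omega>) \<ge> norm z}) \<le> norm (e / of_real (norm z))"
      if "has_expectation \<Omega> \<Sigma> P X (\<lambda>x. of_real (norm x)) e" "z \<noteq> 0" for e z
      using bound[OF that HOL.refl] by (intro norm_phantom_mono)
  qed (use i in blast)
qed

end
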